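(* Let $U$ and $V$ be non-commuting unitary operators on a Hilbert space $H$. Then there are sequences of unitary operators $U_n, V_n \in B(H\oplus H)$ such that $\|[U_n, V_n]\|< \|[U, V]\|$ for all $n$ and the compressions $\mathrm{proj}_H\circ U_n|_H$ and $\mathrm{proj}_H\circ V_n|_H$ of $U_n, V_n$ to $H$ converge in norm to $U$ and $V$ respectively. If $H$ is infinite-dimensional, then there are sequences of unitary operators $U_n, V_n$ on $H$ such that $\|[U_n, V_n]\|< \|[U, V]\|$ for all $n$, $U_n\to U$ $\ast$-strongly and $V_n\to V$ $\ast$-strongly.
   Context: $[X,Y]=XY-YX$. $H$ is identified with the first summand $H\oplus 0$ of $H\oplus H$ and $\mathrm{proj}_H$ is the orthogonal projection onto it. $T_n\to T$ $\ast$-strongly means $T_n\to T$ and $T_n^*\to T^*$ in the strong operator topology. *)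

theory Defs
  imports "HOL-Analysis.Analysis"
begin

section \<open>Complex Hilbert spaces\<close>

text \<open>
  A complex inner product space is presented as a real inner product space carrying in addition
  a compatible complex scalar multiplication and a sesquilinear form whose real part is the real
  inner product. Norm, topology, sums of spaces and bounded operators are thus those of the
  library. The form is linear in its first argument.
\<close>

class complex_vector = real_vector +
  fixes scaleC :: "complex \<Rightarrow> 'a \<Rightarrow> 'a"  (infixr \<open>*\<^sub>C\<close> 75)
  assumes scaleC_add_right: "a *\<^sub>C (x + y) = a *\<^sub>C x + a *\<^sub>C y"
    and scaleC_add_left: "(a + b) *\<^sub>C x = a *\<^sub>C x + b *\<^sub>C x"
    and scaleC_scaleC: "a *\<^sub>C (b *\<^sub>C x) = (a * b) *\<^sub>C x"
    and scaleC_of_real: "complex_of_real r *\<^sub>C x = r *\<^sub>R x"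

class complex_inner = complex_vector + real_inner +
  fixes cinner :: "'a \<Rightarrow> 'a \<Rightarrow> complex"
  assumes cinner_commute: "cinner x y = cnj (cinner y x)"
    and cinner_add_left: "cinner (x + y) z = cinner x z + cinner y z"
    and cinner_scaleC_left: "cinner (a *\<^sub>C x) y = a * cinner x y"
    and Re_cinner: "Re (cinner x y) = inner x y"

class chilbert_space = complex_inner + complete_space

global_interpretation complex_vector:
  vector_space "scaleC :: complex \<Rightarrow> 'a \<Rightarrow> 'a :: complex_vector"
proof
  fix x :: 'a
  show "1 *\<^sub>C x = x"
    using scaleC_of_real[of 1 x] by simp
qed (simp_all add: scaleC_add_right scaleC_add_left scaleC_scaleC)

instantiation complex :: chilbert_space
begin

definition "scaleC a x = a * (x :: complex)"
definition "cinner x y = x * cnj (y :: complex)"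

instance
  by standard
    (simp_all add: scaleC_complex_def cinner_complex_def inner_complex_def
      scaleR_conv_of_real algebra_simps)

end

text \<open>
  The direct sum of Hilbert spaces: the library already makes the product a real inner product
  space, with the inner products of the components added.
\<close>

instantiation prod :: (complex_vector, complex_vector) complex_vector
begin

definition "scaleC a z = (a *\<^sub>C fst z, a *\<^sub>C snd z)"

instance
  by standard
    (simp_all add: scaleC_prod_def scaleC_add_right scaleC_add_left scaleC_scaleC
      scaleC_of_real prod_eq_iff)

end

instantiation prod :: (complex_inner, complex_inner) complex_inner
begin

definition "cinner z w = cinner (fst z) (fst w) + cinner (snd z) (snd w)"

instance
proof
  fix x y :: "'a \<times> 'b"
  show "cinner x y = cnj (cinner y x)"
    unfolding cinner_prod_def complex_cnj_add
    using cinner_commute[of "fst x" "fst y"] cinner_commute[of "snd x" "snd y"] by simp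
qed (simp_all add: cinner_prod_def scaleC_prod_def cinner_add_left cinner_scaleC_left
      Re_cinner inner_prod_def algebra_simps)

end

instance prod :: (chilbert_space, chilbert_space) chilbert_space ..


section \<open>Operators\<close>

text \<open>
  Elements of the library type \<open>'a \<Rightarrow>\<^sub>L 'b\<close> are only real-linear. The space \<open>B(H)\<close> consists of the
  complex-linear ones among them; operator norm, composition and the strong operator topology are
  the same.
\<close>

definition clinear :: "('a::complex_vector \<Rightarrow> 'b::complex_vector) \<Rightarrow> bool"
  where "clinear = Vector_Spaces.linear scaleC scaleC"

definition adj ::
  "('a::chilbert_space \<Rightarrow>\<^sub>L 'b::chilbert_space) \<Rightarrow> ('b \<Rightarrow>\<^sub>L 'a)"
  where "adj T = (THE S. \<forall>x y. cinner (blinfun_apply T x) y = cinner x (blinfun_apply S y))"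

definition unitary :: "('a::chilbert_space \<Rightarrow>\<^sub>L 'a) \<Rightarrow> bool"
  where "unitary T \<longleftrightarrow>
    clinear (blinfun_apply T) \<and> adj T o\<^sub>L T = id_blinfun \<and> T o\<^sub>L adj T = id_blinfun"

definition commutator ::
  "('a::real_normed_vector \<Rightarrow>\<^sub>L 'a) \<Rightarrow> ('a \<Rightarrow>\<^sub>L 'a) \<Rightarrow> ('a \<Rightarrow>\<^sub>L 'a)"
  where "commutator X Y = (X o\<^sub>L Y) - (Y o\<^sub>L X)"

lift_definition first_summand ::
  "'a::real_normed_vector \<Rightarrow>\<^sub>L ('a \<times> 'b::real_normed_vector)" is "\<lambda>h. (h, 0)"
  by (rule bounded_linear_Pair[OF bounded_linear_ident bounded_linear_zero])

text \<open>
  With \<open>H\<close> identified with \<open>H \<oplus> 0\<close> along \<open>first_summand\<close>, the orthogonal projection onto \<open>H\<close>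
  is \<open>fst_blinfun\<close>; see \<open>fst_orthogonal_projection\<close> below.
\<close>

definition compression ::
  "(('a::real_normed_vector \<times> 'a) \<Rightarrow>\<^sub>L ('a \<times> 'a)) \<Rightarrow> ('a \<Rightarrow>\<^sub>L 'a)"
  where "compression T = fst_blinfun o\<^sub>L T o\<^sub>L first_summand"

definition star_strongly ::
  "(nat \<Rightarrow> ('a::chilbert_space \<Rightarrow>\<^sub>L 'a)) \<Rightarrow> ('a \<Rightarrow>\<^sub>L 'a) \<Rightarrow> bool"
  where "star_strongly Tn T \<longleftrightarrow>
    limitin strong_operator_topology Tn T sequentially \<and>
    limitin strong_operator_topology (\<lambda>n. adj (Tn n)) (adj T) sequentially"

definition infinite_dimensional :: "'a::complex_vector itself \<Rightarrow> bool"
  where "infinite_dimensional _ \<longleftrightarrow>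
    \<not> (\<exists>B :: 'a set. finite B \<and> complex_vector.span B = UNIV)"


section \<open>Orthogonal projection onto the first summand and existence of adjoints\<close>

lemma cinner_add_right: "cinner x (y + z) = cinner x y + cinner x z"
  for x :: "'a::complex_inner"
  using cinner_commute[of x "y + z"] cinner_commute[of x y] cinner_commute[of x z]
  by (simp add: cinner_add_left)

lemma cinner_zero_left [simp]: "cinner 0 y = 0" for y :: "'a::complex_inner"
  using cinner_add_left[of 0 0 y] by simp

lemma cinner_zero_right [simp]: "cinner x 0 = 0" for x :: "'a::complex_inner"
  using cinner_commute[of x 0] by simp

lemma Im_cinner: "Im (cinner x y) = - inner (\<i> *\<^sub>C x) y" for x :: "'a::complex_inner"
  using Re_cinner[of "\<i> *\<^sub>C x" y] by (simp add: cinner_scaleC_left)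

lemma fst_orthogonal_projection:
  fixes z :: "'a::complex_inner \<times> 'b::complex_inner"
  shows "cinner (z - blinfun_apply first_summand (blinfun_apply fst_blinfun z))
           (blinfun_apply first_summand h) = 0"
  by (simp add: cinner_prod_def first_summand.rep_eq)

theorem riesz_representation:
  fixes f :: "'a::{real_inner, complete_space} \<Rightarrow> real"
  assumes "bounded_linear f"
  obtains z where "\<And>x. f x = inner x z"
proof -
  interpret f: bounded_linear f by fact
  obtain K where K: "0 < K" "\<And>x. norm (f x) \<le> norm x * K"
    using f.pos_bounded by blast
  define J where "J x = inner x x - 2 * f x" for x
  have bdd: "- (K\<^sup>2) \<le> J x" for x
  proof -
    have "f x \<le> norm x * K" using K(2)[of x] by simp
    then have "(norm x)\<^sup>2 - 2 * (norm x * K) \<le> J x"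
      by (simp add: J_def power2_norm_eq_inner)
    moreover have "0 \<le> (norm x - K)\<^sup>2" by simp
    ultimately show ?thesis by (simp add: power2_diff)
  qed
  define d where "d = (INF x. J x)"
  have bdd': "bdd_below (range J)" using bdd by (rule bdd_belowI2)
  have d_le: "d \<le> J x" for x
    unfolding d_def by (rule cINF_lower[OF bdd']) simp
  have "\<exists>x. J x < d + inverse (real (Suc n))" for n
  proof -
    have "(INF x. J x) < d + inverse (real (Suc n))" by (simp add: d_def)
    then show ?thesis by (subst (asm) cINF_less_iff[OF _ bdd']) auto
  qed
  then obtain X where X: "\<And>n. J (X n) < d + inverse (real (Suc n))" by metis
  have par: "(dist x y)\<^sup>2 \<le> 2 * (J x - d) + 2 * (J y - d)" for x y
  proof -
    have "(dist x y)\<^sup>2 = 2 * J x + 2 * J y - 4 * J ((1/2) *\<^sub>R (x + y))"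
      by (simp add: J_def dist_norm power2_norm_eq_inner f.scaleR f.add inner_commute
          inner_add_left inner_add_right inner_diff_left inner_diff_right)
        (simp add: field_simps)
    then show ?thesis using d_le[of "(1/2) *\<^sub>R (x + y)"] by simp
  qed
  have "Cauchy X"
  proof (rule metric_CauchyI)
    fix e :: real assume "0 < e"
    then obtain N where N: "inverse (real (Suc N)) < e\<^sup>2 / 4"
      using reals_Archimedean[of "e\<^sup>2 / 4"] by auto
    have less: "J (X n) - d < e\<^sup>2 / 4" if "N \<le> n" for n
    proof -
      have "inverse (real (Suc n)) \<le> inverse (real (Suc N))" using that by simp
      then show ?thesis using X[of n] N by linarith
    qed
    have "dist (X m) (X n) < e" if "N \<le> m" "N \<le> n" for m n
    proof -
      have "(dist (X m) (X n))\<^sup>2 < 2 * (e\<^sup>2 / 4) + 2 * (e\<^sup>2 / 4)"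
        using less[OF that(1)] less[OF that(2)]
        by (intro le_less_trans[OF par[of "X m" "X n"]] add_strict_mono mult_strict_left_mono) simp_all
      then have "(dist (X m) (X n))\<^sup>2 < e\<^sup>2" by simp
      then show ?thesis using \<open>0 < e\<close> by (simp add: power_less_imp_less_base)
    qed
    then show "\<exists>M. \<forall>m\<ge>M. \<forall>n\<ge>M. dist (X m) (X n) < e" by blast
  qed
  then obtain z where z: "X \<longlonglongrightarrow> z" using convergent_eq_Cauchy by blast
  have "(\<lambda>n. J (X n)) \<longlonglongrightarrow> J z"
    unfolding J_def by (intro tendsto_intros f.tendsto z)
  moreover have "(\<lambda>n. d + inverse (real (Suc n))) \<longlonglongrightarrow> d + 0"
    by (intro tendsto_intros LIMSEQ_inverse_real_of_nat)
  ultimately have "J z \<le> d"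
    using LIMSEQ_le[of "\<lambda>n. J (X n)" "J z" "\<lambda>n. d + inverse (real (Suc n))" "d + 0"] X
    by (auto intro: less_imp_le)
  then have min: "J z \<le> J x" for x using d_le[of x] by linarith
  have "f x = inner x z" for x
  proof (cases "x = 0")
    case False
    define c where "c = inner x z - f x"
    define p where "p = inner x x"
    have "0 < p" using False by (simp add: p_def)
    have "J (z - t *\<^sub>R x) = J z - 2 * t * c + t\<^sup>2 * p" for t
      by (simp add: J_def c_def p_def f.diff f.scaleR inner_diff_left inner_diff_right
          inner_commute[of z x] power2_eq_square algebra_simps)
    then have "J (z - (c / p) *\<^sub>R x) = J z - 2 * (c / p) * c + (c / p)\<^sup>2 * p" .
    also have "\<dots> = J z - c\<^sup>2 / p"
      using \<open>0 < p\<close> by (simp add: power2_eq_square field_simps)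
    finally have "c\<^sup>2 / p \<le> 0" using min[of "z - (c / p) *\<^sub>R x"] by simp
    then have "c = 0" using \<open>0 < p\<close> by (simp add: divide_le_0_iff)
    then show ?thesis by (simp add: c_def)
  qed (simp add: f.zero)
  then show thesis by (rule that)
qed

theorem cinner_adj:
  fixes T :: "'a::chilbert_space \<Rightarrow>\<^sub>L 'b::chilbert_space"
  assumes "clinear (blinfun_apply T)"
  shows "cinner (blinfun_apply T x) y = cinner x (blinfun_apply (adj T) y)"
proof -
  have T_scaleC: "blinfun_apply T (a *\<^sub>C x) = a *\<^sub>C blinfun_apply T x" for a x
    using assms linear_scale unfolding clinear_def Vector_Spaces.linear_iff by blast
  have "\<exists>z. \<forall>x. inner (blinfun_apply T x) y = inner x z" for y
  proof -
    have "bounded_linear (\<lambda>x. inner (blinfun_apply T x) y)"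
      by (intro bounded_linear_intros blinfun.bounded_linear_right)
    then show ?thesis using riesz_representation by metis
  qed
  then obtain S where S: "\<And>x y. inner (blinfun_apply T x) y = inner x (S y)" by metis
  have ext: "u = v" if "\<And>x. inner x u = inner x v" for u v :: 'a
    using that[of "u - v"] by (metis inner_diff_right inner_eq_zero_iff right_minus_eq diff_self)
  have "bounded_linear S"
  proof (rule bounded_linear_intro[where K = "norm T"])
    show "S (x + y) = S x + S y" for x y
      by (rule ext) (metis S inner_add_right)
    show "S (r *\<^sub>R x) = r *\<^sub>R S x" for r x
      by (rule ext) (metis S inner_scaleR_right)
    show "norm (S y) \<le> norm y * norm T" for y
    proof (cases "S y = 0")
      case False
      have "norm (S y) * norm (S y) = inner (blinfun_apply T (S y)) y"
        by (simp add: S flip: power2_norm_eq_inner power2_eq_square)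
      also have "\<dots> \<le> norm (blinfun_apply T (S y)) * norm y" by (rule norm_cauchy_schwarz)
      also have "\<dots> \<le> (norm T * norm (S y)) * norm y"
        by (intro mult_right_mono norm_blinfun) simp
      finally have "norm (S y) * norm (S y) \<le> norm (S y) * (norm y * norm T)"
        by (simp add: mult_ac)
      then show ?thesis using False by (simp add: mult_le_cancel_left_pos)
    qed simp
  qed
  then have S': "blinfun_apply (Blinfun S) = S" by (rule bounded_linear_Blinfun_apply)
  have "\<forall>x y. cinner (blinfun_apply T x) y = cinner x (blinfun_apply (Blinfun S) y)"
    unfolding S' by (auto intro!: complex_eqI simp: Re_cinner Im_cinner S T_scaleC[symmetric])
  moreover have "R = Blinfun S"
    if "\<forall>x y. cinner (blinfun_apply T x) y = cinner x (blinfun_apply R y)" for R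
  proof (rule blinfun_eqI)
    fix y
    have "inner x (blinfun_apply R y) = inner x (S y)" for x
      using that S by (metis Re_cinner)
    then show "blinfun_apply R y = blinfun_apply (Blinfun S) y"
      unfolding S' by (rule ext)
  qed
  ultimately have "\<forall>x y. cinner (blinfun_apply T x) y = cinner x (blinfun_apply (adj T) y)"
    unfolding adj_def by (rule theI)
  then show ?thesis by blast
qed

end

(*
  Let R be the rotation of H + H by the angle t, C = [U, V], and
    U' = R (U + V),   V' = (V + U) R^*
  (direct sums). Then U' V' = R (UV + VU) R^* and V' U' = VU + UV, so that [U', V'] is cos t
  times the tensor product of C with a reflection of the plane and has norm |cos t| ||C||,
  while the compressions of U' and V' to H are cos t U and cos t V. Let t tend to 0.

  If H is infinite-dimensional, H + H is mapped back to H by unitaries J_n with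
  J_n (h, 0) -> h: an orthonormal basis B is in bijection with B x nat, and J_n fixes the first n
  levels of the basis of the first summand and interleaves its remaining levels with the basis
  of the second. Conjugation by J_n then turns U' and V' into the required sequences.
*)

theory Submission
  imports Defs
begin

section \<open>Unitary pairs\<close>

lemma cinner_scaleC_right: "cinner x (a *\<^sub>C y) = cnj a * cinner x y"
  for x :: "'a::complex_inner"
  using cinner_commute[of x "a *\<^sub>C y"] cinner_commute[of x y] by (simp add: cinner_scaleC_left)

lemma cinner_diff_right: "cinner x (y - z) = cinner x y - cinner x z"
  for x :: "'a::complex_inner"
  using cinner_add_right[of x "y - z" z] by simp

lemma cinner_diff_left: "cinner (x - y) z = cinner x z - cinner y z"
  for x :: "'a::complex_inner"
  using cinner_add_left[of "x - y" y z] by simp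

lemma cinner_scaleR_left: "cinner (r *\<^sub>R x) y = of_real r * cinner x y"
  for x :: "'a::complex_inner"
  by (simp add: cinner_scaleC_left flip: scaleC_of_real)

lemma cinner_scaleR_right: "cinner x (r *\<^sub>R y) = of_real r * cinner x y"
  for x :: "'a::complex_inner"
  by (simp add: cinner_scaleC_right flip: scaleC_of_real)

lemma cinner_self: "cinner x x = of_real ((norm x)\<^sup>2)"
  for x :: "'a::complex_inner"
proof (rule complex_eqI)
  show "Im (cinner x x) = Im (of_real ((norm x)\<^sup>2))"
    using arg_cong[OF cinner_commute[of x x], of Im] by simp
qed (simp add: Re_cinner power2_norm_eq_inner)

text \<open>The norm comes from the real inner product, so its behaviour under complex scalars is
  read off from the form: the squares of both sides are compared as complex numbers.\<close>

lemma norm_scaleC: "norm (a *\<^sub>C x) = cmod a * norm x"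
  for x :: "'a::complex_inner"
proof -
  have "(of_real ((norm (a *\<^sub>C x))\<^sup>2) :: complex) = a * cnj a * cinner x x"
    unfolding cinner_self[symmetric] by (simp add: cinner_scaleC_left cinner_scaleC_right)
  also have "\<dots> = of_real ((cmod a * norm x)\<^sup>2)"
    by (simp add: cinner_self power_mult_distrib flip: complex_norm_square)
  finally show ?thesis
    by (simp only: of_real_eq_iff power2_eq_iff_nonneg[OF norm_ge_zero] mult_nonneg_nonneg norm_ge_zero)
qed

lemma bounded_linear_scaleC: "bounded_linear (\<lambda>x::'a::complex_inner. a *\<^sub>C x)"
proof (rule bounded_linear_intro[where K = "cmod a"])
  show "a *\<^sub>C r *\<^sub>R x = r *\<^sub>R a *\<^sub>C x" for r and x :: 'a
    by (simp add: scaleC_scaleC mult.commute flip: scaleC_of_real)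
qed (simp_all add: scaleC_add_right norm_scaleC mult.commute)

lemma clinear_iff:
  "clinear f \<longleftrightarrow> (\<forall>x y. f (x + y) = f x + f y) \<and> (\<forall>a x. f (a *\<^sub>C x) = a *\<^sub>C f x)"
  unfolding clinear_def Vector_Spaces.linear_iff
  by (auto intro: complex_vector.vector_space_axioms)

section \<open>Unitaries between different spaces\<close>

text \<open>Carrying the adjoint as a second argument avoids the description operator in
  \<open>adj\<close>. Source and target may differ, as they must for the maps from the doubled space
  back to \<open>H\<close>.\<close>

definition unitary_pair ::
  "('a::chilbert_space \<Rightarrow>\<^sub>L 'b::chilbert_space) \<Rightarrow> ('b \<Rightarrow>\<^sub>L 'a) \<Rightarrow> bool"
  where "unitary_pair T S \<longleftrightarrow> clinear (blinfun_apply T) \<and> clinear (blinfun_apply S) \<and>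
    (\<forall>x. S (T x) = x) \<and> (\<forall>y. T (S y) = y) \<and> (\<forall>x y. cinner (T x) y = cinner x (S y))"

text \<open>The hypothesis supplies existence, so uniqueness remains: at each \<open>y\<close> a
  competitor differs from \<open>S\<close> by a vector orthogonal to everything, itself
  included.\<close>

lemma adj_eqI:
  fixes T :: "'a::chilbert_space \<Rightarrow>\<^sub>L 'b::chilbert_space"
  assumes "\<And>x y. cinner (T x) y = cinner x (blinfun_apply S y)"
  shows "adj T = S"
  unfolding adj_def
proof (rule the_equality)
  fix R :: "'b \<Rightarrow>\<^sub>L 'a"
  assume R: "\<forall>x y. cinner (T x) y = cinner x (R y)"
  show "R = S"
  proof (rule blinfun_eqI)
    fix y
    have "cinner (R y - S y) (R y - S y) = 0"
      using R assms by (metis cinner_diff_right right_minus_eq)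
    then show "R y = S y" by (simp add: cinner_self)
  qed
qed (use assms in blast)

lemma unitary_pair_adj: "unitary_pair T S \<Longrightarrow> adj T = S"
  by (rule adj_eqI) (simp add: unitary_pair_def)

lemma unitary_pair_unitary: "unitary_pair T S \<Longrightarrow> unitary T"
  using unitary_pair_adj[of T S]
  by (auto simp: unitary_def unitary_pair_def intro!: blinfun_eqI)

lemma unitary_unitary_pair:
  assumes "unitary T"
  shows "unitary_pair T (adj T)"
proof -
  have T: "clinear (blinfun_apply T)" and inv: "adj T (T x) = x" "T (adj T x) = x" for x
    using assms unfolding unitary_def
    by (auto dest!: arg_cong[where f = "\<lambda>A. blinfun_apply A x"])
  \<comment> \<open>\<open>adj T\<close> is the two-sided inverse of a complex-linear map, hence
    complex-linear.\<close>
  have "clinear (blinfun_apply (adj T))"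
    using T inv unfolding clinear_iff by metis
  with T inv show ?thesis
    using cinner_adj[OF T] by (simp add: unitary_pair_def)
qed

lemma unitary_pair_sym:
  assumes "unitary_pair T S"
  shows "unitary_pair S T"
proof -
  have "cinner (S x) y = cinner x (T y)" for x y
    using assms cinner_commute[of "S x" y] cinner_commute[of x "T y"]
    by (simp add: unitary_pair_def)
  with assms show ?thesis by (simp add: unitary_pair_def)
qed

lemma unitary_pair_compose:
  "unitary_pair T S \<Longrightarrow> unitary_pair T' S' \<Longrightarrow> unitary_pair (T o\<^sub>L T') (S' o\<^sub>L S)"
  by (simp add: unitary_pair_def clinear_iff)

lemma unitary_pair_norm:
  assumes "unitary_pair T S"
  shows "norm (T x) = norm x"
proof -
  have "cinner (T x) (T x) = cinner x x"
    using assms by (simp add: unitary_pair_def)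
  then show ?thesis
    unfolding cinner_self of_real_eq_iff by simp
qed

lemma blinfun_compose_assoc: "A o\<^sub>L (B o\<^sub>L C) = A o\<^sub>L B o\<^sub>L C"
  by (rule blinfun_eqI) simp

section \<open>The dilation on the doubled space\<close>

lift_definition direct_sum ::
  "('a::real_normed_vector \<Rightarrow>\<^sub>L 'a) \<Rightarrow> ('b::real_normed_vector \<Rightarrow>\<^sub>L 'b) \<Rightarrow> ('a \<times> 'b) \<Rightarrow>\<^sub>L ('a \<times> 'b)"
  is "\<lambda>A B z. (A (fst z), B (snd z))"
  by (intro bounded_linear_Pair bounded_linear_compose[OF _ bounded_linear_fst]
      bounded_linear_compose[OF _ bounded_linear_snd])

lift_definition rotation :: "real \<Rightarrow> ('a::real_normed_vector \<times> 'a) \<Rightarrow>\<^sub>L ('a \<times> 'a)"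
  is "\<lambda>t z. (cos t *\<^sub>R fst z - sin t *\<^sub>R snd z, sin t *\<^sub>R fst z + cos t *\<^sub>R snd z)"
  by (intro bounded_linear_Pair bounded_linear_add bounded_linear_sub
      bounded_linear_const_scaleR bounded_linear_fst bounded_linear_snd)

lemma unitary_pair_direct_sum:
  "unitary_pair A A' \<Longrightarrow> unitary_pair B B' \<Longrightarrow> unitary_pair (direct_sum A B) (direct_sum A' B')"
  by (simp add: unitary_pair_def clinear_iff direct_sum.rep_eq cinner_prod_def scaleC_prod_def)

lemma rotation_rotation: "rotation (- t) (rotation t z) = z"
proof -
  have *: "cos t *\<^sub>R cos t *\<^sub>R x + sin t *\<^sub>R sin t *\<^sub>R x = x" for x :: 'a
    by (simp flip: scaleR_add_left power2_eq_square)
  show ?thesis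
    using *[of "fst z"] *[of "snd z"]
    by (simp add: rotation.rep_eq prod_eq_iff algebra_simps)
qed

lemma unitary_pair_rotation:
  "unitary_pair (rotation t :: ('a::chilbert_space \<times> 'a) \<Rightarrow>\<^sub>L _) (rotation (- t))"
proof -
  have lin: "a *\<^sub>C (x - y) = a *\<^sub>C x - a *\<^sub>C y" "a *\<^sub>C r *\<^sub>R x = r *\<^sub>R a *\<^sub>C x"
    for a r and x y :: 'a
    by (simp_all add: linear_simps[OF bounded_linear_scaleC])
  have "clinear (blinfun_apply (rotation t :: ('a \<times> 'a) \<Rightarrow>\<^sub>L _))" for t
    unfolding clinear_iff
    by (simp add: rotation.rep_eq scaleC_prod_def scaleC_add_right lin scaleR_add_right)
  moreover have "cinner (rotation t x) y = cinner x (rotation (- t) y)" for x y :: "'a \<times> 'a"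
    by (simp add: rotation.rep_eq cinner_prod_def cinner_add_left cinner_add_right
        cinner_diff_left cinner_diff_right cinner_scaleR_left cinner_scaleR_right)
  ultimately show ?thesis
    using rotation_rotation[of t] rotation_rotation[of "- t"] by (auto simp: unitary_pair_def)
qed

section \<open>Rotated direct sums and their commutator\<close>

definition dilU :: "real \<Rightarrow> ('a::real_normed_vector \<Rightarrow>\<^sub>L 'a) \<Rightarrow> ('a \<Rightarrow>\<^sub>L 'a) \<Rightarrow> ('a \<times> 'a) \<Rightarrow>\<^sub>L ('a \<times> 'a)"
  where "dilU t U V = rotation t o\<^sub>L direct_sum U V"

text \<open>The order of the factors makes the rotations cancel in
  \<open>dilV t U V o\<^sub>L dilU t U V\<close>, while the opposite product is a direct sum
  conjugated by the rotation. At a quarter turn this conjugation exchanges the summands and the two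
  products agree; small angles start off towards that commuting pair.\<close>

definition dilV :: "real \<Rightarrow> ('a::real_normed_vector \<Rightarrow>\<^sub>L 'a) \<Rightarrow> ('a \<Rightarrow>\<^sub>L 'a) \<Rightarrow> ('a \<times> 'a) \<Rightarrow>\<^sub>L ('a \<times> 'a)"
  where "dilV t U V = direct_sum V U o\<^sub>L rotation (- t)"

text \<open>Besides unitarity this gives the adjoints in closed form, from which their strong
  convergence is read off later.\<close>

lemma unitary_pair_dil:
  assumes "unitary U" "unitary V"
  shows "unitary_pair (dilU t U V) (direct_sum (adj U) (adj V) o\<^sub>L rotation (- t))"
    and "unitary_pair (dilV t U V) (rotation t o\<^sub>L direct_sum (adj V) (adj U))"
  unfolding dilU_def dilV_def
  using unitary_pair_rotation[of t] unitary_pair_rotation[of "- t"] assms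
  by (auto intro!: unitary_pair_compose unitary_pair_direct_sum unitary_unitary_pair)

text \<open>
  The commutator is \<open>cos t\<close> times the tensor product of \<open>commutator U V\<close> with the reflection
  with rows \<open>(cos t, sin t)\<close> and \<open>(sin t, - cos t)\<close>.
\<close>

lemma commutator_dil:
  "commutator (dilU t U V) (dilV t U V) (x, y) =
    cos t *\<^sub>R (commutator U V (cos t *\<^sub>R x + sin t *\<^sub>R y), commutator U V (sin t *\<^sub>R x - cos t *\<^sub>R y))"
proof -
  \<comment> \<open>The Pythagorean identity, oriented so that simplification removes squared
    cosines.\<close>
  have cs: "cos t *\<^sub>R cos t *\<^sub>R z = z - sin t *\<^sub>R sin t *\<^sub>R z" for z :: 'a
  proof -
    have "cos t *\<^sub>R cos t *\<^sub>R z + sin t *\<^sub>R sin t *\<^sub>R z = z"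
      by (simp flip: scaleR_add_left power2_eq_square)
    then show ?thesis by (simp add: algebra_simps)
  qed
  show ?thesis
    by (simp add: commutator_def dilU_def dilV_def direct_sum.rep_eq rotation.rep_eq
        blinfun.bilinear_simps scaleR_add_right scaleR_diff_right cs)
      (simp add: algebra_simps)
qed

text \<open>The reflection in \<open>commutator_dil\<close> preserves the norm of the direct sum,
  and one operator acting in both components stretches by at most its own norm. Only the factor
  \<open>cos t\<close> is left.\<close>

lemma norm_commutator_dil_le:
  fixes U V :: "'a::chilbert_space \<Rightarrow>\<^sub>L 'a"
  shows "norm (commutator (dilU t U V) (dilV t U V)) \<le> \<bar>cos t\<bar> * norm (commutator U V)"
proof (rule norm_blinfun_bound)
  fix z :: "'a \<times> 'a"
  obtain x y where z: "z = (x, y)" by (cases z)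
  let ?C = "commutator U V"
  let ?p = "cos t *\<^sub>R x + sin t *\<^sub>R y" and ?q = "sin t *\<^sub>R x - cos t *\<^sub>R y"
  have "(norm ?p)\<^sup>2 + (norm ?q)\<^sup>2 = ((cos t)\<^sup>2 + (sin t)\<^sup>2) * ((norm x)\<^sup>2 + (norm y)\<^sup>2)"
    unfolding power2_norm_eq_inner inner_add_left inner_add_right inner_diff_left inner_diff_right
      inner_scaleR_left inner_scaleR_right inner_commute[of y x]
    by algebra
  then have pq: "norm (?p, ?q) = norm z"
    unfolding z by (simp add: norm_Pair)
  have "norm (?C ?p, ?C ?q) \<le> norm ?C * norm (?p, ?q)"
  proof -
    have "(norm (?C w))\<^sup>2 \<le> (norm ?C)\<^sup>2 * (norm w)\<^sup>2" for w
      using power_mono[OF norm_blinfun[of ?C w], of 2] by (simp add: power_mult_distrib)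
    then have "(norm (?C ?p))\<^sup>2 + (norm (?C ?q))\<^sup>2 \<le> (norm ?C)\<^sup>2 * ((norm ?p)\<^sup>2 + (norm ?q)\<^sup>2)"
      by (simp add: distrib_left add_mono)
    then show ?thesis
      by - (rule power2_le_imp_le, simp_all add: norm_Pair power_mult_distrib)
  qed
  then show "norm (commutator (dilU t U V) (dilV t U V) z) \<le> \<bar>cos t\<bar> * norm ?C * norm z"
    unfolding z commutator_dil norm_scaleR pq[unfolded z]
    by (simp add: mult.assoc mult_left_mono)
qed simp

lemma compression_dil: "compression (dilU t U V) = cos t *\<^sub>R U" "compression (dilV t U V) = cos t *\<^sub>R V"
  by (auto intro!: blinfun_eqI simp: compression_def dilU_def dilV_def direct_sum.rep_eq
      rotation.rep_eq first_summand.rep_eq blinfun.bilinear_simps)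

section \<open>Extending isometric correspondences\<close>

text \<open>The projection theorem: \<open>x\<close> has a nearest point \<open>z\<close> in
  \<open>S\<close>, and \<open>x - z\<close> is orthogonal to \<open>S\<close>, hence zero.\<close>

lemma closed_subspace_eq_UNIV:
  fixes S :: "'a::{real_inner, complete_space} set"
  assumes "subspace S" "closed S" and orth: "\<And>x. (\<And>y. y \<in> S \<Longrightarrow> inner x y = 0) \<Longrightarrow> x = 0"
  shows "S = UNIV"
proof -
  have "x \<in> S" for x
  proof -
    have ne: "S \<noteq> {}" using subspace_0[OF \<open>subspace S\<close>] by auto
    define d where "d = infdist x S"
    have d_le: "d \<le> norm (x - y)" if "y \<in> S" for y
      using infdist_le[OF that, of x] by (simp add: d_def dist_norm)
    have "d \<ge> 0" by (simp add: d_def infdist_nonneg)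
    have "\<exists>y\<in>S. norm (x - y) < d + inverse (real (Suc n))" for n
    proof -
      have "(INF y\<in>S. dist x y) < d + inverse (real (Suc n))"
        using ne by (simp add: d_def infdist_def)
      moreover have "bdd_below (dist x ` S)" by (rule bdd_belowI2[where m = 0]) simp
      ultimately obtain y where "y \<in> S" "dist x y < d + inverse (real (Suc n))"
        using cINF_less_iff[OF ne] by blast
      then show ?thesis by (auto simp only: dist_norm)
    qed
    then obtain Y where Y: "\<And>n. Y n \<in> S" "\<And>n. norm (x - Y n) < d + inverse (real (Suc n))"
      by metis
    have lim: "(\<lambda>n. norm (x - Y n)) \<longlonglongrightarrow> d"
    proof (rule tendsto_sandwich[OF _ _ tendsto_const])
      show "(\<lambda>n. d + inverse (real (Suc n))) \<longlonglongrightarrow> d"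
        using tendsto_add[OF tendsto_const LIMSEQ_inverse_real_of_nat, of d] by simp
      show "\<forall>\<^sub>F n in sequentially. d \<le> norm (x - Y n)"
        by (simp add: d_le Y(1))
      show "\<forall>\<^sub>F n in sequentially. norm (x - Y n) \<le> d + inverse (real (Suc n))"
        by (intro always_eventually allI less_imp_le Y(2))
    qed
    \<comment> \<open>Parallelogram law: the midpoint of \<open>u\<close> and \<open>v\<close> lies
      in \<open>S\<close>, so its distance from \<open>x\<close> is at least \<open>d\<close>.
      Points that nearly attain \<open>d\<close> are therefore close to each other.\<close>
    have par: "(dist u v)\<^sup>2 \<le> 2 * ((norm (x - u))\<^sup>2 - d\<^sup>2) + 2 * ((norm (x - v))\<^sup>2 - d\<^sup>2)"
      if "u \<in> S" "v \<in> S" for u v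
    proof -
      let ?m = "(1/2) *\<^sub>R (u + v)"
      have "?m \<in> S" using that \<open>subspace S\<close> by (simp add: subspace_add subspace_scale)
      then have "d\<^sup>2 \<le> (norm (x - ?m))\<^sup>2" using d_le \<open>d \<ge> 0\<close> by (simp add: power_mono)
      moreover have "(dist u v)\<^sup>2 = 2 * (norm (x - u))\<^sup>2 + 2 * (norm (x - v))\<^sup>2 - 4 * (norm (x - ?m))\<^sup>2"
        by (simp add: dist_norm power2_norm_eq_inner inner_commute
          inner_add_left inner_add_right inner_diff_left inner_diff_right) (simp add: field_simps)
      ultimately show ?thesis by simp
    qed
    have "Cauchy Y"
    proof (rule metric_CauchyI)
      fix e :: real assume "0 < e"
      have "(\<lambda>n. (norm (x - Y n))\<^sup>2) \<longlonglongrightarrow> d\<^sup>2" by (intro tendsto_intros lim)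
      then have "\<forall>\<^sub>F n in sequentially. (norm (x - Y n))\<^sup>2 < d\<^sup>2 + e\<^sup>2 / 4"
        by (rule order_tendstoD) (use \<open>0 < e\<close> in simp)
      then obtain N where N: "\<And>n. n \<ge> N \<Longrightarrow> (norm (x - Y n))\<^sup>2 < d\<^sup>2 + e\<^sup>2 / 4"
        by (auto simp: eventually_sequentially)
      have arith: "a < h" if "a \<le> 2 * (b - k) + 2 * (c - k)" "b < k + h / 4" "c < k + h / 4"
        for a b c h k :: real
        using that by (simp add: field_simps)
      have "dist (Y m) (Y n) < e" if "m \<ge> N" "n \<ge> N" for m n
      proof -
        have "(dist (Y m) (Y n))\<^sup>2 < e\<^sup>2"
          by (rule arith[OF par[OF Y(1) Y(1), of m n] N[OF that(1)] N[OF that(2)]])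
        then show ?thesis using \<open>0 < e\<close> by (simp add: power_less_imp_less_base)
      qed
      then show "\<exists>M. \<forall>m\<ge>M. \<forall>n\<ge>M. dist (Y m) (Y n) < e" by blast
    qed
    then obtain z where z: "Y \<longlonglongrightarrow> z" using convergent_eq_Cauchy by blast
    then have "z \<in> S" using \<open>closed S\<close> Y closed_sequentially by blast
    have "(\<lambda>n. norm (x - Y n)) \<longlonglongrightarrow> norm (x - z)" by (intro tendsto_intros z)
    then have dz: "norm (x - z) = d" using lim LIMSEQ_unique by blast
    have "inner (x - z) y = 0" if "y \<in> S" for y
    proof (cases "y = 0")
      case False
      \<comment> \<open>\<open>c / p\<close> is the coefficient of the projection of
        \<open>x - z\<close> onto the line of \<open>y\<close>. Moving \<open>z\<close> by this
        multiple of \<open>y\<close> lowers the squared distance by \<open>c\<^sup>2 / p\<close>,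
        which minimality permits only for \<open>c = 0\<close>.\<close>
      define c where "c = inner (x - z) y"
      define p where "p = inner y y"
      have "0 < p" using False by (simp add: p_def)
      have "z + (c / p) *\<^sub>R y \<in> S"
        using \<open>z \<in> S\<close> that \<open>subspace S\<close> by (simp add: subspace_add subspace_scale)
      then have "d\<^sup>2 \<le> (norm (x - (z + (c / p) *\<^sub>R y)))\<^sup>2"
        using d_le \<open>d \<ge> 0\<close> by (simp add: power_mono)
      also have "\<dots> = (norm ((x - z) - (c / p) *\<^sub>R y))\<^sup>2"
        by (simp add: algebra_simps)
      also have "\<dots> = (norm (x - z))\<^sup>2 - 2 * (c / p) * c + (c / p)\<^sup>2 * p"
        unfolding power2_norm_eq_inner inner_diff_left[of "x - z"] inner_diff_right[of _ "x - z"]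
        by (simp add: c_def p_def inner_commute[of y "x - z"] power2_eq_square)
      also have "\<dots> = d\<^sup>2 - c\<^sup>2 / p"
        using \<open>0 < p\<close> by (simp add: dz power2_eq_square field_simps)
      finally have "c\<^sup>2 / p \<le> 0" by simp
      then show ?thesis using \<open>0 < p\<close> by (simp add: divide_le_0_iff c_def)
    qed simp
    then have "x - z = 0" by (rule orth)
    with \<open>z \<in> S\<close> show ?thesis by simp
  qed
  then show ?thesis by auto
qed

lemma csubspace_closure:
  fixes S :: "'a::complex_inner set"
  assumes "complex_vector.subspace S"
  shows "complex_vector.subspace (closure S)"
proof (rule complex_vector.subspaceI)
  show "0 \<in> closure S"
    using complex_vector.subspace_0[OF assms] closure_subset by blast
  fix x y assume "x \<in> closure S" "y \<in> closure S"
  then obtain X Y where "\<forall>n. X n \<in> S" "X \<longlonglongrightarrow> x" "\<forall>n. Y n \<in> S" "Y \<longlonglongrightarrow> y"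
    unfolding closure_sequential by blast
  then show "x + y \<in> closure S"
    unfolding closure_sequential
    using complex_vector.subspace_add[OF assms] tendsto_add[of X x _ Y y]
    by (intro exI[of _ "\<lambda>n. X n + Y n"]) auto
next
  fix a x assume "x \<in> closure S"
  then obtain X where "\<forall>n. X n \<in> S" "X \<longlonglongrightarrow> x"
    unfolding closure_sequential by blast
  then show "a *\<^sub>C x \<in> closure S"
    unfolding closure_sequential
    using complex_vector.subspace_scale[OF assms] bounded_linear.tendsto[OF bounded_linear_scaleC]
    by (intro exI[of _ "\<lambda>n. a *\<^sub>C X n"]) auto
qed

lemma csubspace_subspace: "complex_vector.subspace S \<Longrightarrow> subspace S"
  unfolding subspace_def complex_vector.subspace_def by (metis scaleC_of_real)

text \<open>\<open>S\<close> is stable under multiplication by \<open>\<i>\<close>, so orthogonality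
  to it in the real inner product already implies orthogonality for \<open>cinner\<close>, and the
  real criterion applies.\<close>

lemma closed_csubspace_eq_UNIV:
  fixes S :: "'a::chilbert_space set"
  assumes "complex_vector.subspace S" "closed S"
    and orth: "\<And>x. (\<And>y. y \<in> S \<Longrightarrow> cinner x y = 0) \<Longrightarrow> x = 0"
  shows "S = UNIV"
proof (rule closed_subspace_eq_UNIV)
  fix x assume 0: "inner x y = 0" if "y \<in> S" for y
  have "cinner x y = 0" if "y \<in> S" for y
  proof (rule complex_eqI)
    have "inner x (\<i> *\<^sub>C y) = 0"
      using 0 that complex_vector.subspace_scale[OF assms(1)] by blast
    then show "Im (cinner x y) = Im 0"
      by (simp add: cinner_scaleC_right flip: Re_cinner)
  qed (use 0 that in \<open>simp add: Re_cinner\<close>)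
  then show "x = 0" by (rule orth)
qed (use assms csubspace_subspace in auto)

section \<open>Unitaries as closed linear relations\<close>

text \<open>The domain of a closed norm-preserving linear relation is closed, so totality makes it
  everything. Applied to a graph and to its converse, this gives a map that is everywhere defined
  and onto.\<close>

lemma fst_isometric_relation_UNIV:
  fixes M :: "('k::chilbert_space \<times> 'l::chilbert_space) set"
  assumes sub: "complex_vector.subspace M" and "closed M"
    and norm: "\<And>p. p \<in> M \<Longrightarrow> norm (fst p) = norm (snd p)"
    and total: "\<And>x. (\<And>p. p \<in> M \<Longrightarrow> cinner x (fst p) = 0) \<Longrightarrow> x = 0"
  shows "fst ` M = UNIV"
proof (rule closed_csubspace_eq_UNIV)
  show "complex_vector.subspace (fst ` M)"
  proof (rule complex_vector.subspaceI)
    show "0 \<in> fst ` M" using complex_vector.subspace_0[OF sub] by force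
    show "x + y \<in> fst ` M" if "x \<in> fst ` M" "y \<in> fst ` M" for x y
      using that complex_vector.subspace_add[OF sub] by (force simp flip: fst_add)
    show "a *\<^sub>C x \<in> fst ` M" if x: "x \<in> fst ` M" for a x
    proof -
      obtain p where "p \<in> M" "x = fst p" using x by blast
      then have "a *\<^sub>C p \<in> M" "a *\<^sub>C x = fst (a *\<^sub>C p)"
        using complex_vector.subspace_scale[OF sub] by (auto simp: scaleC_prod_def)
      then show ?thesis by blast
    qed
  qed
  show "closed (fst ` M)"
    unfolding closed_sequential_limits
  proof (intro allI impI, elim conjE)
    fix X x assume "\<forall>n::nat. X n \<in> fst ` M" and X: "X \<longlonglongrightarrow> x"
    then have "\<forall>n. \<exists>p. p \<in> M \<and> X n = fst p" by blast
    then obtain P where P: "\<And>n. P n \<in> M" "\<And>n. X n = fst (P n)" by metis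
    \<comment> \<open>Differences of pairs in \<open>M\<close> stay in \<open>M\<close>, so
      convergence of the first components forces the second ones to be Cauchy.\<close>
    have "dist (snd (P m)) (snd (P n)) = dist (X m) (X n)" for m n
      using norm[of "P m - P n"] P subspace_diff[OF csubspace_subspace[OF sub]]
      by (simp add: dist_norm)
    moreover have "Cauchy X" using X by (rule LIMSEQ_imp_Cauchy)
    ultimately have "Cauchy (\<lambda>n. snd (P n))" by (simp add: Cauchy_def)
    then obtain y where "(\<lambda>n. snd (P n)) \<longlonglongrightarrow> y" using convergent_eq_Cauchy by blast
    with X have "(\<lambda>n. (X n, snd (P n))) \<longlonglongrightarrow> (x, y)" by (intro tendsto_Pair)
    then have "(x, y) \<in> M"
      by (rule closed_sequentially[OF \<open>closed M\<close>, rotated]) (simp add: P)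
    then show "x \<in> fst ` M" by force
  qed
qed (use total in blast)

text \<open>
  The closed linear span of \<open>E\<close> is the graph of the unitary.
\<close>

lemma unitary_extension:
  fixes E :: "('k::chilbert_space \<times> 'l::chilbert_space) set"
  assumes iso: "\<And>p q. p \<in> E \<Longrightarrow> q \<in> E \<Longrightarrow> cinner (fst p) (fst q) = cinner (snd p) (snd q)"
    and fst_total: "\<And>x. (\<And>p. p \<in> E \<Longrightarrow> cinner x (fst p) = 0) \<Longrightarrow> x = 0"
    and snd_total: "\<And>y. (\<And>p. p \<in> E \<Longrightarrow> cinner y (snd p) = 0) \<Longrightarrow> y = 0"
  obtains J J' where "unitary_pair J J'" "\<And>p. p \<in> E \<Longrightarrow> blinfun_apply J (fst p) = snd p"
proof -
  define G where "G = complex_vector.span E"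
  define M where "M = closure G"
  have sub: "complex_vector.subspace M"
    unfolding M_def G_def by (intro csubspace_closure complex_vector.subspace_span)
  have EM: "E \<subseteq> M"
    using complex_vector.span_superset closure_subset unfolding M_def G_def by blast
  have GE: "cinner (fst p) (fst q) = cinner (snd p) (snd q)" if "p \<in> G" "q \<in> E" for p q
    using that(1) unfolding G_def
    by (induction rule: complex_vector.span_induct_alt)
      (use that(2) iso in \<open>simp_all add: scaleC_prod_def cinner_add_left cinner_scaleC_left\<close>)
  have G: "cinner (fst p) (fst q) = cinner (snd p) (snd q)" if "p \<in> G" "q \<in> G" for p q
    using that(2) that(1) unfolding G_def
    by (induction rule: complex_vector.span_induct_alt)
      (use GE in \<open>simp_all add: G_def scaleC_prod_def cinner_add_right cinner_scaleC_right\<close>)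
  \<comment> \<open>The identity passes to the closure one argument at a time, by continuity of the
    real inner product. The complex form is recovered afterwards by multiplying with
    \<open>\<i>\<close>.\<close>
  have "M \<subseteq> {p. inner (fst p) (fst q) = inner (snd p) (snd q)}" if "q \<in> G" for q
    unfolding M_def
    by (intro closure_minimal closed_Collect_eq continuous_intros)
      (rule subsetI, simp add: G that flip: Re_cinner)
  then have "M \<subseteq> {q. inner (fst p) (fst q) = inner (snd p) (snd q)}" if "p \<in> M" for p
    unfolding M_def using that[unfolded M_def]
    by (intro closure_minimal closed_Collect_eq continuous_intros) auto
  then have inner: "inner (fst p) (fst q) = inner (snd p) (snd q)" if "p \<in> M" "q \<in> M" for p q
    using that by blast
  have cinner: "cinner (fst p) (fst q) = cinner (snd p) (snd q)" if "p \<in> M" "q \<in> M" for p q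
    using inner[OF that] inner[of "\<i> *\<^sub>C p" q] that complex_vector.subspace_scale[OF sub]
    by (intro complex_eqI) (auto simp: Re_cinner Im_cinner scaleC_prod_def)
  have norm: "norm (fst p) = norm (snd p)" if "p \<in> M" for p
    using inner[OF that that] by (simp add: norm_eq_sqrt_inner)
  have "fst ` M = UNIV"
  proof (rule fst_isometric_relation_UNIV[OF sub])
    show "x = 0" if "\<And>p. p \<in> M \<Longrightarrow> cinner x (fst p) = 0" for x
      using that EM by (intro fst_total) blast
  qed (simp_all add: M_def norm[unfolded M_def])
  moreover have "snd ` M = UNIV"
  proof -
    \<comment> \<open>The converse relation has the same properties with the factors exchanged, so
      the same lemma yields surjectivity.\<close>
    define s :: "'k \<times> 'l \<Rightarrow> 'l \<times> 'k" where "s = prod.swap"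
    have "closed (s ` M)"
    proof -
      have "s ` M = prod.swap -` M" by (force simp: s_def)
      then show ?thesis
        by (auto simp: M_def prod.swap_def intro!: closed_vimage continuous_intros)
    qed
    moreover have "complex_vector.subspace (s ` M)"
    proof (rule complex_vector.subspaceI)
      show "0 \<in> s ` M"
        using complex_vector.subspace_0[OF sub] by (force simp: s_def zero_prod_def)
      show "x + y \<in> s ` M" if xy: "x \<in> s ` M" "y \<in> s ` M" for x y
      proof -
        obtain p q where "p \<in> M" "q \<in> M" "x = s p" "y = s q" using xy by blast
        then have "p + q \<in> M" "x + y = s (p + q)"
          using complex_vector.subspace_add[OF sub] by (auto simp: s_def prod_eq_iff)
        then show ?thesis by blast
      qed
      show "a *\<^sub>C x \<in> s ` M" if x: "x \<in> s ` M" for a x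
      proof -
        obtain p where "p \<in> M" "x = s p" using x by blast
        then have "a *\<^sub>C p \<in> M" "a *\<^sub>C x = s (a *\<^sub>C p)"
          using complex_vector.subspace_scale[OF sub] by (auto simp: s_def scaleC_prod_def)
        then show ?thesis by blast
      qed
    qed
    ultimately have "fst ` s ` M = UNIV"
    proof (intro fst_isometric_relation_UNIV)
      show "norm (fst p) = norm (snd p)" if "p \<in> s ` M" for p
        using that norm by (auto simp: s_def)
      show "y = 0" if y: "\<And>p. p \<in> s ` M \<Longrightarrow> cinner y (fst p) = 0" for y
      proof (rule snd_total)
        show "cinner y (snd p) = 0" if "p \<in> E" for p
          using y[of "s p"] that EM by (auto simp: s_def)
      qed
    qed
    then show ?thesis by (simp add: s_def image_image)
  qed
  ultimately have "\<forall>x. \<exists>y. (x, y) \<in> M" "\<forall>y. \<exists>x. (x, y) \<in> M"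
    by (metis UNIV_I imageE prod.collapse)+
  then obtain j j' where j: "\<And>x. (x, j x) \<in> M" and j': "\<And>y. (j' y, y) \<in> M" by metis
  \<comment> \<open>By equality of norms, a pair in \<open>M\<close> vanishes as soon as one
    component does. For differences of pairs this says that \<open>M\<close> is single-valued in
    both directions, so \<open>j\<close> and \<open>j'\<close> inherit linearity from
    \<open>M\<close>.\<close>
  have zero: "fst p = 0 \<longleftrightarrow> snd p = 0" if "p \<in> M" for p
    using norm[OF that] by (metis norm_eq_zero)
  have minus: "p - q \<in> M" if "p \<in> M" "q \<in> M" for p q
    using that subspace_diff[OF csubspace_subspace[OF sub]] by blast
  have j_eq: "j x = y" and j'_eq: "j' y = x" if "(x, y) \<in> M" for x y
    using zero[OF minus[OF j[of x] that]] zero[OF minus[OF j'[of y] that]] by auto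
  have add: "(x + x', y + y') \<in> M" if "(x, y) \<in> M" "(x', y') \<in> M" for x x' y y'
    using complex_vector.subspace_add[OF sub that] by simp
  have scale: "(a *\<^sub>C x, a *\<^sub>C y) \<in> M" if "(x, y) \<in> M" for a x y
    using complex_vector.subspace_scale[OF sub that, of a] by (simp add: scaleC_prod_def)
  have scaleR: "(a *\<^sub>R x, a *\<^sub>R y) \<in> M" if "(x, y) \<in> M" for a x y
    using scale[OF that, of "of_real a"] by (simp add: scaleC_of_real)
  have "bounded_linear j"
    by (rule bounded_linear_intro[where K = 1])
      (use norm[OF j] in \<open>auto intro!: j_eq add scaleR j\<close>)
  then have J: "blinfun_apply (Blinfun j) = j" by (rule bounded_linear_Blinfun_apply)
  have "bounded_linear j'"
    by (rule bounded_linear_intro[where K = 1])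
      (use norm[OF j'] in \<open>auto intro!: j'_eq add scaleR j'\<close>)
  then have J': "blinfun_apply (Blinfun j') = j'" by (rule bounded_linear_Blinfun_apply)
  show thesis
  proof
    show "unitary_pair (Blinfun j) (Blinfun j')"
      unfolding unitary_pair_def J J' clinear_iff
      using cinner[OF j j'] by (auto intro!: j_eq j'_eq add scale j j')
    show "Blinfun j (fst p) = snd p" if "p \<in> E" for p
      unfolding J by (rule j_eq) (use that EM in auto)
  qed
qed

section \<open>Absorbing the second summand\<close>

definition orthonormal :: "'a::complex_inner set \<Rightarrow> bool"
  where "orthonormal B \<longleftrightarrow> (\<forall>b\<in>B. \<forall>c\<in>B. cinner b c = (if b = c then 1 else 0))"

text \<open>Completeness is expressed by a trivial orthogonal complement: maximality of an
  orthonormal set delivers it in this form, and \<open>unitary_extension\<close> asks for it in this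
  form.\<close>

definition total :: "'a::complex_inner set \<Rightarrow> bool"
  where "total B \<longleftrightarrow> (\<forall>x. (\<forall>b\<in>B. cinner x b = 0) \<longrightarrow> x = 0)"

text \<open>Zorn's lemma: a nonzero vector orthogonal to a maximal orthonormal set could be
  normalized and adjoined.\<close>

lemma orthonormal_total_exists: "\<exists>B :: 'a::complex_inner set. orthonormal B \<and> total B"
proof -
  have "\<exists>B\<in>Collect orthonormal. \<forall>X\<in>Collect orthonormal. B \<subseteq> X \<longrightarrow> X = (B :: 'a set)"
  proof (rule subset_Zorn')
    fix C :: "'a set set" assume C: "subset.chain (Collect orthonormal) C"
    have "cinner b c = (if b = c then 1 else 0)" if bc: "b \<in> \<Union>C" "c \<in> \<Union>C" for b c
    proof -
      from bc obtain X Y where "X \<in> C" "b \<in> X" "Y \<in> C" "c \<in> Y" by blast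
      moreover from this have "X \<subseteq> Y \<or> Y \<subseteq> X" using C by (auto simp: subset_chain_def)
      ultimately obtain Z where "Z \<in> C" "b \<in> Z" "c \<in> Z" by blast
      then show ?thesis using C by (auto simp: subset_chain_def orthonormal_def)
    qed
    then show "\<Union>C \<in> Collect orthonormal" by (simp add: orthonormal_def)
  qed
  then obtain B :: "'a set" where B: "orthonormal B" "\<And>X. orthonormal X \<Longrightarrow> B \<subseteq> X \<Longrightarrow> X = B"
    by blast
  have "x = 0" if x: "\<forall>b\<in>B. cinner x b = 0" for x
  proof (rule ccontr)
    assume "x \<noteq> 0"
    define e where "e = inverse (norm x) *\<^sub>R x"
    have e: "cinner e b = 0" "cinner b e = 0" if "b \<in> B" for b
      using x that cinner_commute[of b x] by (auto simp: e_def cinner_scaleR_left cinner_scaleR_right)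
    have "cinner e e = 1"
      using \<open>x \<noteq> 0\<close> by (simp add: cinner_self e_def)
    then have "orthonormal (insert e B)" "e \<notin> B"
      using B(1) e by (auto simp: orthonormal_def)
    then show False using B(2)[of "insert e B"] by blast
  qed
  with B(1) show ?thesis unfolding total_def by blast
qed

text \<open>If \<open>B\<close> were finite, each \<open>x\<close> would have a Fourier sum over
  \<open>B\<close> whose difference from \<open>x\<close> is orthogonal to \<open>B\<close>, hence
  zero; so \<open>B\<close> would span.\<close>

lemma orthonormal_total_infinite:
  fixes B :: "'a::complex_inner set"
  assumes "infinite_dimensional TYPE('a)" "orthonormal B" "total B"
  shows "infinite B"
proof
  assume "finite B"
  have sum_left: "cinner (sum f F) y = (\<Sum>b\<in>F. cinner (f b) y)" for f F and y :: 'a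
    by (induction F rule: infinite_finite_induct) (simp_all add: cinner_add_left)
  have "x \<in> complex_vector.span B" for x
  proof -
    define p where "p = (\<Sum>b\<in>B. cinner x b *\<^sub>C b)"
    have "cinner p c = cinner x c" if "c \<in> B" for c
    proof -
      have "cinner p c = (\<Sum>b\<in>B. if b = c then cinner x b else 0)"
        unfolding p_def sum_left
        by (rule sum.cong) (use \<open>orthonormal B\<close> that in \<open>auto simp: orthonormal_def cinner_scaleC_left\<close>)
      then show ?thesis using \<open>finite B\<close> that by simp
    qed
    then have "cinner (x - p) c = 0" if "c \<in> B" for c
      using that cinner_add_left[of "x - p" p c] by simp
    then have "x - p = 0" using \<open>total B\<close> unfolding total_def by blast
    then have "x = p" by simp
    moreover have "p \<in> complex_vector.span B"
      unfolding p_def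
      by (simp add: complex_vector.span_sum complex_vector.span_scale complex_vector.span_base)
    ultimately show ?thesis by simp
  qed
  then show False
    using assms(1) \<open>finite B\<close> by (auto simp: infinite_dimensional_def)
qed

text \<open>
  On \<open>B \<times> nat\<close> the two maps fix the first \<open>n\<close> levels and interleave everything above.
\<close>

lemma infinite_split:
  assumes "infinite B"
  obtains f g :: "nat \<Rightarrow> 'a \<Rightarrow> 'a"
  where "\<And>n. inj_on (f n) B" "\<And>n. inj_on (g n) B" "\<And>n. f n ` B \<inter> g n ` B = {}"
    "\<And>n. f n ` B \<union> g n ` B = B" "\<And>b. b \<in> B \<Longrightarrow> \<forall>\<^sub>F n in sequentially. f n b = b"
proof -
  \<comment> \<open>An infinite set absorbs a countable factor, so \<open>B\<close> is arranged in
    levels indexed by \<open>nat\<close>. Uncountable bases, that is non-separable spaces, are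
    covered too.\<close>
  have "(card_of (UNIV :: nat set), card_of B) \<in> ordLeq"
    using assms infinite_iff_card_of_nat by blast
  then have "(card_of B, card_of (B \<times> (UNIV :: nat set))) \<in> ordIso"
    using card_of_Times_infinite[OF assms, of "UNIV :: nat set"] ordIso_symmetric by blast
  then obtain h where h: "bij_betw h B (B \<times> (UNIV :: nat set))"
    using card_of_ordIso by blast
  define k where "k = inv_into B h"
  have k: "k (h b) = b" if "b \<in> B" for b
    using h that by (simp add: k_def bij_betw_inv_into_left)
  have hk: "h (k p) = p" "k p \<in> B" if "fst p \<in> B" for p
  proof -
    have "p \<in> B \<times> UNIV" using that by (cases p) auto
    then show "h (k p) = p" "k p \<in> B"
      unfolding k_def using bij_betw_inv_into_right[OF h] bij_betwE[OF bij_betw_inv_into[OF h]]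
      by blast+
  qed
  have hB: "fst (h b) \<in> B" if "b \<in> B" for b
    using bij_betwE[OF h] that by (metis mem_Times_iff)
  \<comment> \<open>Levels from \<open>n\<close> on are divided by the parity of their distance from
    \<open>n\<close>: even distances belong to the range of \<open>\<sigma> n\<close>, odd ones to
    that of \<open>\<tau> n\<close>.\<close>
  define \<sigma> :: "nat \<Rightarrow> nat \<Rightarrow> nat" where "\<sigma> n m = (if m < n then m else n + 2 * (m - n))" for n m
  define \<tau> :: "nat \<Rightarrow> nat \<Rightarrow> nat" where "\<tau> n m = n + 2 * m + 1" for n m
  define f where "f n b = k (fst (h b), \<sigma> n (snd (h b)))" for n b
  define g where "g n b = k (fst (h b), \<tau> n (snd (h b)))" for n b
  have hf: "h (f n b) = (fst (h b), \<sigma> n (snd (h b)))" "f n b \<in> B" if "b \<in> B" for n b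
    using that hk hB by (auto simp: f_def)
  have hg: "h (g n b) = (fst (h b), \<tau> n (snd (h b)))" "g n b \<in> B" if "b \<in> B" for n b
    using that hk hB by (auto simp: g_def)
  have inj: "b = c" if "b \<in> B" "c \<in> B" "h b = h c" for b c
    using that k by metis
  have \<sigma>_inj: "\<sigma> n m = \<sigma> n m' \<Longrightarrow> m = m'" for n m m'
    by (auto simp: \<sigma>_def split: if_splits)
  have \<tau>_inj: "\<tau> n m = \<tau> n m' \<Longrightarrow> m = m'" for n m m'
    by (simp add: \<tau>_def)
  have \<sigma>\<tau>: "\<sigma> n m \<noteq> \<tau> n m'" for n m m'
    unfolding \<sigma>_def \<tau>_def by presburger
  have \<sigma>\<tau>_surj: "(\<exists>m'. m = \<sigma> n m') \<or> (\<exists>m'. m = \<tau> n m')" for n m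
  proof -
    consider "m < n" | i where "m = n + 2 * i" | i where "m = n + 2 * i + 1"
    proof -
      have "m < n \<or> m = n + 2 * ((m - n) div 2) \<or> m = n + 2 * ((m - n) div 2) + 1"
        by presburger
      then show thesis using that by blast
    qed
    then show ?thesis
    proof cases
      case 1
      then have "m = \<sigma> n m" by (simp add: \<sigma>_def)
      then show ?thesis by blast
    next
      case 2
      then have "m = \<sigma> n (n + i)" by (simp add: \<sigma>_def)
      then show ?thesis by blast
    next
      case 3
      then have "m = \<tau> n i" by (simp add: \<tau>_def)
      then show ?thesis by blast
    qed
  qed
  show thesis
  proof
    show "inj_on (f n) B" for n
    proof (rule inj_onI)
      fix b c assume bc: "b \<in> B" "c \<in> B" and "f n b = f n c"
      then have "h (f n b) = h (f n c)" by simp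
      then have "fst (h b) = fst (h c)" "\<sigma> n (snd (h b)) = \<sigma> n (snd (h c))"
        unfolding hf(1)[OF bc(1)] hf(1)[OF bc(2)] by simp_all
      then have "h b = h c" using \<sigma>_inj by (simp add: prod_eq_iff)
      then show "b = c" by (rule inj[OF bc])
    qed
    show "inj_on (g n) B" for n
    proof (rule inj_onI)
      fix b c assume bc: "b \<in> B" "c \<in> B" and "g n b = g n c"
      then have "h (g n b) = h (g n c)" by simp
      then have "fst (h b) = fst (h c)" "\<tau> n (snd (h b)) = \<tau> n (snd (h c))"
        unfolding hg(1)[OF bc(1)] hg(1)[OF bc(2)] by simp_all
      then have "h b = h c" using \<tau>_inj by (simp add: prod_eq_iff)
      then show "b = c" by (rule inj[OF bc])
    qed
    have "f n b \<noteq> g n c" if "b \<in> B" "c \<in> B" for n b c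
    proof
      assume "f n b = g n c"
      then have "h (f n b) = h (g n c)" by simp
      then show False
        unfolding hf(1)[OF that(1)] hg(1)[OF that(2)] using \<sigma>\<tau> by simp
    qed
    then show "f n ` B \<inter> g n ` B = {}" for n by blast
    have "b \<in> f n ` B \<union> g n ` B" if "b \<in> B" for n b
    proof -
      define i m where "i = fst (h b)" and "m = snd (h b)"
      have "i \<in> B" using hB that by (simp add: i_def)
      from \<sigma>\<tau>_surj[of m n] show ?thesis
      proof (elim disjE exE)
        fix m' assume m': "m = \<sigma> n m'"
        have "f n (k (i, m')) = k (i, m)"
          using \<open>i \<in> B\<close> by (simp add: f_def hk m')
        then have "f n (k (i, m')) = b"
          using k[OF that] by (simp add: i_def m_def)
        moreover have "k (i, m') \<in> B" using \<open>i \<in> B\<close> hk by simp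
        ultimately show ?thesis by blast
      next
        fix m' assume m': "m = \<tau> n m'"
        have "g n (k (i, m')) = k (i, m)"
          using \<open>i \<in> B\<close> by (simp add: g_def hk m')
        then have "g n (k (i, m')) = b"
          using k[OF that] by (simp add: i_def m_def)
        moreover have "k (i, m') \<in> B" using \<open>i \<in> B\<close> hk by simp
        ultimately show ?thesis by blast
      qed
    qed
    then show "f n ` B \<union> g n ` B = B" for n
      using hf hg by blast
    show "\<forall>\<^sub>F n in sequentially. f n b = b" if "b \<in> B" for b
      \<comment> \<open>Every \<open>b\<close> sits on the finite level \<open>snd (h b)\<close> and
        is fixed once \<open>n\<close> exceeds it.\<close>
      using eventually_gt_at_top[of "snd (h b)"]
      by eventually_elim (simp add: f_def \<sigma>_def k that)
  qed
qed

section \<open>Unitaries from the doubled space onto the original one\<close>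

lemma absorbing_unitaries:
  assumes "infinite_dimensional TYPE('a::chilbert_space)"
  obtains J :: "nat \<Rightarrow> ('a::chilbert_space \<times> 'a) \<Rightarrow>\<^sub>L 'a" and J' :: "nat \<Rightarrow> 'a::chilbert_space \<Rightarrow>\<^sub>L ('a \<times> 'a)"
  where "\<And>n. unitary_pair (J n) (J' n)" "\<And>x. (\<lambda>n. J n (x, 0)) \<longlonglongrightarrow> x"
proof -
  obtain B :: "'a set" where B: "orthonormal B" "total B"
    using orthonormal_total_exists by blast
  obtain f g :: "nat \<Rightarrow> 'a \<Rightarrow> 'a"
    where inj: "\<And>n. inj_on (f n) B" "\<And>n. inj_on (g n) B" and disj: "\<And>n. f n ` B \<inter> g n ` B = {}"
    and un: "\<And>n. f n ` B \<union> g n ` B = B" and ev: "\<And>b. b \<in> B \<Longrightarrow> \<forall>\<^sub>F n in sequentially. f n b = b"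
    using infinite_split[OF orthonormal_total_infinite[OF assms B]] by blast
  \<comment> \<open>Writing the inverse as \<open>adj J\<close> leaves a single operator to be
    chosen for each \<open>n\<close>.\<close>
  have "\<exists>J :: ('a \<times> 'a) \<Rightarrow>\<^sub>L 'a. unitary_pair J (adj J) \<and> (\<forall>b\<in>B. blinfun_apply J (b, 0) = f n b)" for n
  proof -
    \<comment> \<open>The two copies of \<open>B\<close> in the summands form an orthonormal basis
      of the doubled space, and \<open>f n\<close>, \<open>g n\<close> together map it bijectively
      onto \<open>B\<close>.\<close>
    define E where "E = (\<lambda>b. ((b, 0), f n b)) ` B \<union> (\<lambda>b. ((0, b), g n b)) ` B"
    have fg: "f n b \<in> B" "g n b \<in> B" if "b \<in> B" for b
      using that un by blast+
    have ne: "f n b \<noteq> g n c" "g n c \<noteq> f n b" if "b \<in> B" "c \<in> B" for b c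
      using that disj[of n] by (metis disjoint_iff imageI)+
    have on: "cinner b c = (if b = c then 1 else 0)" if "b \<in> B" "c \<in> B" for b c
      using B(1) that by (simp add: orthonormal_def)
    have eq: "f n b = f n c \<longleftrightarrow> b = c" "g n b = g n c \<longleftrightarrow> b = c" if "b \<in> B" "c \<in> B" for b c
      using that by (auto simp: inj_on_eq_iff[OF inj(1)] inj_on_eq_iff[OF inj(2)])
    obtain J J' where J: "unitary_pair J J'" "\<And>p. p \<in> E \<Longrightarrow> blinfun_apply J (fst p) = snd p"
    proof (rule unitary_extension[of E])
      show "cinner (fst p) (fst q) = cinner (snd p) (snd q)" if "p \<in> E" "q \<in> E" for p q
        using that unfolding E_def by (auto simp: cinner_prod_def on fg eq ne)
      show "x = 0" if x: "\<And>p. p \<in> E \<Longrightarrow> cinner x (fst p) = 0" for x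
      proof -
        have "cinner (fst x) b = 0" "cinner (snd x) b = 0" if "b \<in> B" for b
          using x[of "((b, 0), f n b)"] x[of "((0, b), g n b)"] that
          by (auto simp: E_def cinner_prod_def)
        then show ?thesis using B(2) by (simp add: total_def prod_eq_iff)
      qed
      show "y = 0" if y: "\<And>p. p \<in> E \<Longrightarrow> cinner y (snd p) = 0" for y
      proof -
        have "cinner y c = 0" if "c \<in> B" for c
        proof -
          have "c \<in> f n ` B \<union> g n ` B" using that un by blast
          then have "\<exists>p\<in>E. snd p = c" by (force simp: E_def)
          then show ?thesis using y by blast
        qed
        then show ?thesis using B(2) by (simp add: total_def)
      qed
    qed (rule that)
    show ?thesis
    proof (rule exI[of _ J], rule conjI, unfold unitary_pair_adj[OF J(1)], rule J(1), rule ballI)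
      show "blinfun_apply J (b, 0) = f n b" if "b \<in> B" for b
        using J(2)[of "((b, 0), f n b)"] that by (simp add: E_def)
    qed
  qed
  then have "\<forall>n. \<exists>J :: ('a \<times> 'a) \<Rightarrow>\<^sub>L 'a. unitary_pair J (adj J) \<and> (\<forall>b\<in>B. blinfun_apply J (b, 0) = f n b)"
    ..
  from choice[OF this] obtain J :: "nat \<Rightarrow> ('a \<times> 'a) \<Rightarrow>\<^sub>L 'a"
    where "\<forall>n. unitary_pair (J n) (adj (J n)) \<and> (\<forall>b\<in>B. blinfun_apply (J n) (b, 0) = f n b)"
    ..
  then have J: "unitary_pair (J n) (adj (J n))"
    and Jf: "b \<in> B \<Longrightarrow> blinfun_apply (J n) (b, 0) = f n b" for n b
    by simp_all
  \<comment> \<open>On \<open>B\<close> the sequence is eventually constant, so it suffices that the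
    vectors with the desired convergence form a closed complex subspace.\<close>
  define S where "S = {x. (\<lambda>n. J n (x, 0)) \<longlonglongrightarrow> x}"
  have "S = UNIV"
  proof (rule closed_csubspace_eq_UNIV)
    have scaleC_J: "J n (a *\<^sub>C x, 0) = a *\<^sub>C J n (x, 0)" for n a x
    proof -
      have "(a *\<^sub>C x, 0) = a *\<^sub>C (x, 0 :: 'a)" by (simp add: scaleC_prod_def)
      then show ?thesis using J[of n] by (simp add: unitary_pair_def clinear_iff)
    qed
    have add_J: "J n (x + y, 0) = J n (x, 0) + J n (y, 0)" for n x y
      by (simp flip: blinfun.add_right)
    show "complex_vector.subspace S"
      by (rule complex_vector.subspaceI)
        (auto simp: S_def add_J scaleC_J blinfun.zero_right simp flip: zero_prod_def
          intro: tendsto_add bounded_linear.tendsto[OF bounded_linear_scaleC])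
    show "closed S"
      unfolding closed_sequential_limits
    proof (intro allI impI, elim conjE)
      fix X x assume XS: "\<forall>m::nat. X m \<in> S" and X: "X \<longlonglongrightarrow> x"
      show "x \<in> S"
        unfolding S_def mem_Collect_eq
      proof (rule metric_LIMSEQ_I)
        fix e :: real assume "0 < e"
        then obtain m where m: "dist (X m) x < e / 3"
          using metric_LIMSEQ_D[OF X, of "e / 3"] by auto
        obtain N where N: "\<And>n. n \<ge> N \<Longrightarrow> dist (J n (X m, 0)) (X m) < e / 3"
          using XS metric_LIMSEQ_D[of "\<lambda>n. J n (X m, 0)" "X m" "e / 3"] \<open>0 < e\<close>
          by (auto simp: S_def)
        \<comment> \<open>Of the three errors, the one from replacing \<open>x\<close> by
          \<open>X m\<close> under \<open>J n\<close> is independent of \<open>n\<close>, because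
          \<open>J n\<close> is isometric.\<close>
        have "dist (J n (x, 0)) x < e" if "n \<ge> N" for n
        proof -
          have "dist (J n (x, 0)) (J n (X m, 0)) = dist (X m) x"
            using unitary_pair_norm[OF J, of n "(x, 0) - (X m, 0)"]
            by (simp add: dist_norm blinfun.diff_right norm_minus_commute del: diff_Pair)
              (simp add: norm_minus_commute)
          then show ?thesis
            using m N[OF that] dist_triangle[of "J n (x, 0)" x "J n (X m, 0)"]
              dist_triangle[of "J n (X m, 0)" x "X m"] by linarith
        qed
        then show "\<exists>N. \<forall>n\<ge>N. dist (J n (x, 0)) x < e" by blast
      qed
    qed
    have "b \<in> S" if "b \<in> B" for b
      unfolding S_def mem_Collect_eq Jf[OF that]
      by (rule tendsto_eventually) (use ev[OF that] in simp)
    then show "x = 0" if "\<And>y. y \<in> S \<Longrightarrow> cinner x y = 0" for x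
      using that B(2) by (auto simp: total_def)
  qed
  then have "(\<lambda>n. J n (x, 0)) \<longlonglongrightarrow> x" for x by (auto simp: S_def)
  with J show thesis by (rule that)
qed

section \<open>Transport to the original space\<close>

text \<open>The strong operator topology is the pullback of the product topology along
  \<open>blinfun_apply\<close>, and convergence in the product is componentwise.\<close>

lemma limitin_strong_operator_topologyI:
  assumes "\<And>x. (\<lambda>n. blinfun_apply (T n) x) \<longlonglongrightarrow> blinfun_apply A x"
  shows "limitin strong_operator_topology T A sequentially"
proof -
  have "limitin (product_topology (\<lambda>i. euclidean) UNIV) (\<lambda>n. blinfun_apply (T n))
    (blinfun_apply A) sequentially"
    unfolding limitin_componentwise using assms by (auto simp: extensional_def)
  then have lim: "limitin euclidean (\<lambda>n. blinfun_apply (T n)) (blinfun_apply A) sequentially"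
    by (simp add: euclidean_product_topology)
  show ?thesis
    unfolding limitin_def strong_operator_topology_topspace
  proof (intro conjI allI impI UNIV_I, elim conjE)
    fix W assume "openin strong_operator_topology W" "A \<in> W"
    then obtain Y where "openin euclidean Y" "W = blinfun_apply -` Y \<inter> UNIV"
      unfolding strong_operator_topology_def openin_pullback_topology by blast
    with lim \<open>A \<in> W\<close> show "\<forall>\<^sub>F n in sequentially. T n \<in> W"
      unfolding limitin_def by simp
  qed
qed

text \<open>\<open>J'\<close> cancels \<open>J\<close> between the factors, so the commutator itself
  is conjugated, and \<open>J\<close> and \<open>J'\<close> are isometric.\<close>

lemma norm_commutator_conj_le:
  assumes "unitary_pair J J'"
  shows "norm (commutator (J o\<^sub>L X o\<^sub>L J') (J o\<^sub>L Y o\<^sub>L J')) \<le> norm (commutator X Y)"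
proof (rule norm_blinfun_bound)
  have inv: "J' (J z) = z" for z
    using assms by (simp add: unitary_pair_def)
  fix x
  have "commutator (J o\<^sub>L X o\<^sub>L J') (J o\<^sub>L Y o\<^sub>L J') x = J (commutator X Y (J' x))"
    by (simp add: commutator_def blinfun.diff_left blinfun.diff_right inv)
  then have "norm (commutator (J o\<^sub>L X o\<^sub>L J') (J o\<^sub>L Y o\<^sub>L J') x) = norm (commutator X Y (J' x))"
    using unitary_pair_norm[OF assms] by simp
  also have "\<dots> \<le> norm (commutator X Y) * norm (J' x)" by (rule norm_blinfun)
  also have "norm (J' x) = norm x" by (rule unitary_pair_norm[OF unitary_pair_sym[OF assms]])
  finally show "norm (commutator (J o\<^sub>L X o\<^sub>L J') (J o\<^sub>L Y o\<^sub>L J') x) \<le> norm (commutator X Y) * norm x" .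
qed simp

text \<open>By isometry, \<open>J' n x\<close> is as close to \<open>(x, 0)\<close> as
  \<open>J n (x, 0)\<close> is to \<open>x\<close>. Hence \<open>T n (J' n x)\<close> approaches
  \<open>(y, 0)\<close>, which \<open>J n\<close> carries close to \<open>y\<close>. The zero in the
  second component of the limit matters, since \<open>J n\<close> is controlled on the first summand
  only.\<close>

lemma tendsto_conj:
  fixes J :: "nat \<Rightarrow> ('a::chilbert_space \<times> 'a) \<Rightarrow>\<^sub>L 'a"
  assumes J: "\<And>n. unitary_pair (J n) (J' n)" "\<And>x. (\<lambda>n. J n (x, 0)) \<longlonglongrightarrow> x"
    and T: "\<And>n. unitary_pair (T n) (S n)"
    and lim: "(\<lambda>n. T n (x, 0)) \<longlonglongrightarrow> (y, 0)"
  shows "(\<lambda>n. (J n o\<^sub>L T n o\<^sub>L J' n) x) \<longlonglongrightarrow> y"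
proof (rule LIM_zero_cancel, rule tendsto_norm_zero_cancel, rule tendsto_sandwich[OF _ _ tendsto_const])
  let ?b = "\<lambda>n. norm (J n (x, 0) - x) + norm (T n (x, 0) - (y, 0)) + norm (J n (y, 0) - y)"
  show "?b \<longlonglongrightarrow> 0"
    using tendsto_add[OF tendsto_add[OF tendsto_norm_zero[OF LIM_zero[OF J(2)[of x]]]
          tendsto_norm_zero[OF LIM_zero[OF lim]]] tendsto_norm_zero[OF LIM_zero[OF J(2)[of y]]]]
    by simp
  have "norm ((J n o\<^sub>L T n o\<^sub>L J' n) x - y) \<le> ?b n" for n
  proof -
    have JJ': "J n (J' n x) = x"
      using J(1)[of n] by (simp add: unitary_pair_def)
    have "norm (J n (T n (J' n x)) - J n (T n (x, 0))) = norm (J n (x, 0) - x)"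
      using unitary_pair_norm[OF J(1), of n "T n (J' n x - (x, 0))"]
        unitary_pair_norm[OF T, of n "J' n x - (x, 0)"]
        unitary_pair_norm[OF J(1), of n "J' n x - (x, 0)"]
      by (simp add: blinfun.diff_right JJ' norm_minus_commute)
    moreover have "norm (J n (T n (x, 0)) - J n (y, 0)) = norm (T n (x, 0) - (y, 0))"
      using unitary_pair_norm[OF J(1), of n "T n (x, 0) - (y, 0)"]
      by (simp add: blinfun.diff_right)
    moreover have "norm ((J n o\<^sub>L T n o\<^sub>L J' n) x - y) \<le> norm (J n (T n (J' n x)) - J n (T n (x, 0)))
        + norm (J n (T n (x, 0)) - J n (y, 0)) + norm (J n (y, 0) - y)"
      unfolding blinfun_apply_blinfun_compose by norm
    ultimately show ?thesis by simp
  qed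
  then show "\<forall>\<^sub>F n in sequentially. norm ((J n o\<^sub>L T n o\<^sub>L J' n) x - y) \<le> ?b n"
    by simp
qed simp

text \<open>The adjoint of the conjugate of \<open>T n\<close> is the conjugate of
  \<open>S n\<close>, so convergence of the adjoints is \<open>tendsto_conj\<close> with
  \<open>T\<close> and \<open>S\<close> exchanged.\<close>

lemma star_strongly_conj:
  fixes J :: "nat \<Rightarrow> ('a::chilbert_space \<times> 'a) \<Rightarrow>\<^sub>L 'a"
  assumes J: "\<And>n. unitary_pair (J n) (J' n)" "\<And>x. (\<lambda>n. J n (x, 0)) \<longlonglongrightarrow> x"
    and T: "\<And>n. unitary_pair (T n) (S n)"
    and lim: "\<And>x. (\<lambda>n. T n (x, 0)) \<longlonglongrightarrow> (blinfun_apply A x, 0)" "\<And>x. (\<lambda>n. S n (x, 0)) \<longlonglongrightarrow> (adj A x, 0)"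
  shows "unitary (J n o\<^sub>L T n o\<^sub>L J' n)" and "star_strongly (\<lambda>n. J n o\<^sub>L T n o\<^sub>L J' n) A"
proof -
  have pair: "unitary_pair (J n o\<^sub>L T n o\<^sub>L J' n) (J n o\<^sub>L S n o\<^sub>L J' n)" for n
    using unitary_pair_compose[OF unitary_pair_compose[OF J(1)[of n] T[of n]]
        unitary_pair_sym[OF J(1)[of n]]]
    by (simp add: blinfun_compose_assoc)
  then show "unitary (J n o\<^sub>L T n o\<^sub>L J' n)"
    by (rule unitary_pair_unitary)
  show "star_strongly (\<lambda>n. J n o\<^sub>L T n o\<^sub>L J' n) A"
    unfolding star_strongly_def unitary_pair_adj[OF pair]
    by (intro conjI limitin_strong_operator_topologyI tendsto_conj[OF J T lim(1)]
        tendsto_conj[OF J unitary_pair_sym[OF T] lim(2)])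
qed

theorem theorem6p5:
  fixes U V :: "'a::chilbert_space \<Rightarrow>\<^sub>L 'a"
  assumes "unitary U" and "unitary V" and "commutator U V \<noteq> 0"
  shows "(\<exists>(Us :: nat \<Rightarrow> ('a \<times> 'a) \<Rightarrow>\<^sub>L ('a \<times> 'a)) (Vs :: nat \<Rightarrow> ('a \<times> 'a) \<Rightarrow>\<^sub>L ('a \<times> 'a)).
            (\<forall>n. unitary (Us n) \<and> unitary (Vs n)
                 \<and> norm (commutator (Us n) (Vs n)) < norm (commutator U V))
            \<and> (\<lambda>n. compression (Us n)) \<longlonglongrightarrow> U
            \<and> (\<lambda>n. compression (Vs n)) \<longlonglongrightarrow> V)
       \<and> (infinite_dimensional TYPE('a) \<longrightarrow>
          (\<exists>(Us :: nat \<Rightarrow> 'a \<Rightarrow>\<^sub>L 'a) (Vs :: nat \<Rightarrow> 'a \<Rightarrow>\<^sub>L 'a).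
            (\<forall>n. unitary (Us n) \<and> unitary (Vs n)
                 \<and> norm (commutator (Us n) (Vs n)) < norm (commutator U V))
            \<and> star_strongly Us U
            \<and> star_strongly Vs V))"
proof -
  \<comment> \<open>The angles tend to 0 but lie strictly between 0 and \<open>pi / 2\<close>, where
    the cosine is strictly between 0 and 1. This makes the decrease of the commutator norm strict
    for every \<open>n\<close>.\<close>
  define t where "t n = inverse (real (Suc n))" for n
  have t: "0 < t n" "t n \<le> 1" for n
    by (auto simp: t_def field_simps)
  have "t \<longlonglongrightarrow> 0"
    unfolding t_def by (rule LIMSEQ_inverse_real_of_nat)
  then have cos: "(\<lambda>n. cos (t n)) \<longlonglongrightarrow> 1" and sin: "(\<lambda>n. sin (t n)) \<longlonglongrightarrow> 0"
    using tendsto_cos[of t 0] tendsto_sin[of t 0] by auto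
  have cos_less: "\<bar>cos (t n)\<bar> < 1" for n
  proof -
    have "t n < pi / 2" using t[of n] pi_gt3 by linarith
    then have "0 < cos (t n)" using t[of n] by (intro cos_gt_zero_pi) auto
    moreover have "cos (t n) < cos 0"
      using t[of n] pi_gt3 by (intro cos_monotone_0_pi) auto
    ultimately show ?thesis by simp
  qed
  define Us where "Us n = dilU (t n) U V" for n
  define Vs where "Vs n = dilV (t n) U V" for n
  have pU: "unitary_pair (Us n) (direct_sum (adj U) (adj V) o\<^sub>L rotation (- t n))"
    and pV: "unitary_pair (Vs n) (rotation (t n) o\<^sub>L direct_sum (adj V) (adj U))" for n
    unfolding Us_def Vs_def by (rule unitary_pair_dil[OF assms(1,2)])+
  have less: "norm (commutator (Us n) (Vs n)) < norm (commutator U V)" for n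
  proof -
    have "norm (commutator (Us n) (Vs n)) \<le> \<bar>cos (t n)\<bar> * norm (commutator U V)"
      unfolding Us_def Vs_def by (rule norm_commutator_dil_le)
    \<comment> \<open>Non-commutativity enters here: the factor below 1 is multiplied by a positive
      norm.\<close>
    also have "\<dots> < 1 * norm (commutator U V)"
      using cos_less assms(3) by (intro mult_strict_right_mono) auto
    finally show ?thesis by simp
  qed
  \<comment> \<open>The type of \<open>z\<close> is left open, as the fact is applied to operators
    for the compressions and to vectors for strong convergence.\<close>
  have scale: "(\<lambda>n. cos (t n) *\<^sub>R z) \<longlonglongrightarrow> z" for z :: "'b::real_normed_vector"
    using tendsto_scaleR[OF cos tendsto_const, of z] by simp
  have scale0: "(\<lambda>n. sin (t n) *\<^sub>R z) \<longlonglongrightarrow> 0" for z :: 'a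
    using tendsto_scaleR[OF sin tendsto_const, of z] by simp
  have "(\<lambda>n. compression (Us n)) \<longlonglongrightarrow> U" "(\<lambda>n. compression (Vs n)) \<longlonglongrightarrow> V"
    unfolding Us_def Vs_def compression_dil by (rule scale)+
  then have part1: "\<exists>(Us :: nat \<Rightarrow> ('a \<times> 'a) \<Rightarrow>\<^sub>L ('a \<times> 'a)) (Vs :: nat \<Rightarrow> ('a \<times> 'a) \<Rightarrow>\<^sub>L ('a \<times> 'a)).
      (\<forall>n. unitary (Us n) \<and> unitary (Vs n)
        \<and> norm (commutator (Us n) (Vs n)) < norm (commutator U V))
      \<and> (\<lambda>n. compression (Us n)) \<longlonglongrightarrow> U \<and> (\<lambda>n. compression (Vs n)) \<longlonglongrightarrow> V"
    using less pU[THEN unitary_pair_unitary] pV[THEN unitary_pair_unitary] by blast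
  have part2: "\<exists>(Us :: nat \<Rightarrow> 'a \<Rightarrow>\<^sub>L 'a) (Vs :: nat \<Rightarrow> 'a \<Rightarrow>\<^sub>L 'a).
      (\<forall>n. unitary (Us n) \<and> unitary (Vs n)
        \<and> norm (commutator (Us n) (Vs n)) < norm (commutator U V))
      \<and> star_strongly Us U \<and> star_strongly Vs V"
    if inf: "infinite_dimensional TYPE('a)"
  proof -
    obtain J :: "nat \<Rightarrow> ('a \<times> 'a) \<Rightarrow>\<^sub>L 'a" and J'
      where J: "\<And>n. unitary_pair (J n) (J' n)" "\<And>x. (\<lambda>n. J n (x, 0)) \<longlonglongrightarrow> x"
      by (rule absorbing_unitaries[OF inf]) (rule that)
    \<comment> \<open>In each of the four limits the second component carries the factor
      \<open>sin (t n)\<close> up to sign, so it vanishes whichever of \<open>U\<close>,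
      \<open>V\<close> or their adjoints it contains.\<close>
    have U1: "(\<lambda>n. Us n (x, 0)) \<longlonglongrightarrow> (U x, 0)" for x
      by (auto simp: Us_def dilU_def direct_sum.rep_eq rotation.rep_eq blinfun.zero_right
          intro!: tendsto_Pair scale scale0)
    have U2: "(\<lambda>n. (direct_sum (adj U) (adj V) o\<^sub>L rotation (- t n)) (x, 0)) \<longlonglongrightarrow> (adj U x, 0)" for x
      using tendsto_minus[OF scale0]
      by (auto simp: direct_sum.rep_eq rotation.rep_eq blinfun.scaleR_right blinfun.minus_right
          intro!: tendsto_Pair scale)
    note U' = star_strongly_conj[OF J pU U1 U2]
    have V1: "(\<lambda>n. Vs n (x, 0)) \<longlonglongrightarrow> (V x, 0)" for x
      using tendsto_minus[OF scale0]
      by (auto simp: Vs_def dilV_def direct_sum.rep_eq rotation.rep_eq blinfun.scaleR_right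
          blinfun.minus_right intro!: tendsto_Pair scale)
    have V2: "(\<lambda>n. (rotation (t n) o\<^sub>L direct_sum (adj V) (adj U)) (x, 0)) \<longlonglongrightarrow> (adj V x, 0)" for x
      by (auto simp: direct_sum.rep_eq rotation.rep_eq blinfun.zero_right
          intro!: tendsto_Pair scale scale0)
    note V' = star_strongly_conj[OF J pV V1 V2]
    show ?thesis
    proof (intro exI conjI allI)
      show "norm (commutator (J n o\<^sub>L Us n o\<^sub>L J' n) (J n o\<^sub>L Vs n o\<^sub>L J' n))
          < norm (commutator U V)" for n
        using norm_commutator_conj_le[OF J(1)] less by (rule le_less_trans)
    qed (rule U' V')+
  qed
  from part1 part2 show ?thesis by blast
qed

end
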